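(* Let $d\ge 1$ be an integer, let $\alpha>\frac d2$ be a non-integer with integer part $[\alpha]$, and let $\kappa>0$. Let $a_0=1$ and $a_k=\frac{\alpha(\alpha-1)\cdots(\alpha-k+1)}{k!}$ for $k\ge 1$. For each integer $J\ge 1$ put $K=[\alpha]+2J+1$. Then: (i) There is a constant $c>0$, independent of $J$, such that $$c\left(1+|\xi|^{d+2}\right)\le \sum_{k=0}^{K}a_k\,\kappa^{2(\alpha-k)}|\xi|^{2k}\qquad\text{for all }\xi\in\mathbb{R}^d .$$ (ii) There are non-negative polynomials $q_j$, $j=1,2,\dots$ (not depending on $J$), such that for every $J\ge 1$, with $K=[\alpha]+2J+1$, $$\sum_{j=1}^{J}q_j(|\xi|)\le\sum_{k=0}^{K}a_k\,\kappa^{2(\alpha-k)}|\xi|^{2k}\qquad\text{for all }\xi\in\mathbb{R}^d,$$ and $$\lim_{J\to\infty}\sum_{j=1}^{J}q_j(t)=+\infty\qquad\text{for all }t>\kappa .$$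
   Context: The numbers $a_k$ are the generalized binomial coefficients, so that $(\kappa^2+t^2)^\alpha=\sum_{k=0}^\infty a_k\kappa^{2(\alpha-k)}t^{2k}$ for $|t|\le\kappa$. The sums in the claim are truncations of this Taylor series evaluated at $t=|\xi|$. *)

theory Defs
  imports
    "HOL-Analysis.Analysis"
    "HOL-Computational_Algebra.Polynomial"
begin

text \<open>
  The truncation after the term \<open>k = K\<close> of the Taylor series of \<open>(\<kappa>\<^sup>2 + t\<^sup>2) powr \<alpha>\<close> at \<open>t = 0\<close>.
\<close>

definition taylor_trunc :: "real \<Rightarrow> real \<Rightarrow> nat \<Rightarrow> real \<Rightarrow> real" where
  "taylor_trunc \<alpha> \<kappa> K t = (\<Sum>k=0..K. (\<alpha> gchoose k) * \<kappa> powr (2 * (\<alpha> - real k)) * t ^ (2 * k))"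

text \<open>The truncation order \<open>K = [\<alpha>] + 2J + 1\<close>; used only for \<open>\<alpha> > 0\<close>, where \<open>nat\<close> loses nothing.\<close>

definition trunc_order :: "real \<Rightarrow> nat \<Rightarrow> nat" where
  "trunc_order \<alpha> J = nat \<lfloor>\<alpha>\<rfloor> + 2 * J + 1"

text \<open>Non-negativity as a function on the whole real line, not of the coefficients.\<close>

definition nonneg_poly :: "real poly \<Rightarrow> bool" where
  "nonneg_poly p \<longleftrightarrow> (\<forall>x. poly p x \<ge> 0)"

end

theory Submission imports Defs "HOL-Real_Asymp.Real_Asymp"
begin

text \<open>
  Let \<open>n = [\<alpha>] + 1\<close> and write \<open>T\<^sub>k\<close> for the \<open>k\<close>-th term of the Taylor series. Then
  \<open>T\<^sub>0, \<dots>, T\<^sub>n\<close> have non-negative coefficients, and from \<open>n\<close> on the signs alternate. A truncation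
  with \<open>K = n + 2J\<close> thus ends with a positive term, and sharing each even-offset term equally between
  its two negative neighbours gives
  \[ \sum_{k=0}^{n+2J} T_k = \sum_{k<n} T_k + \frac12 T_n + \sum_{j=1}^J q_j + \frac12 T_{n+2J},
     \qquad q_j = \frac12 (T_k + 2 T_{k+1} + T_{k+2}), \quad k = n + 2j - 2. \]

  The \<open>q\<^sub>j\<close> are non-negative because the absolute values of the coefficients are log-convex. In detail,
  with \<open>x = (t / \<kappa>)\<^sup>2\<close> and \<open>\<rho>\<^sub>k = (k - \<alpha>) / (k + 1)\<close>, the recurrence \<open>T\<^sub>k\<^sub>+\<^sub>1 = - \<rho>\<^sub>k x T\<^sub>k\<close> completes
  the square,
  \[ q_j = \frac12 T_k \left( (1 - \rho_k x)^2 + \rho_k (\rho_{k+1} - \rho_k) x^2 \right), \]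
  and \<open>\<rho>\<close> is strictly increasing. Each of the two summands proves one half of the claim.

  The second one, for \<open>j = 1\<close>, is a positive multiple of \<open>t\<close> to the power \<open>2n + 4 \<ge> d + 2\<close> that does not
  depend on \<open>J\<close>; with the constant term \<open>T\<^sub>0\<close> this is the uniform lower bound.

  The first one gives divergence. If \<open>t > \<kappa>\<close> then \<open>\<rho>\<^sub>k x\<close> tends to \<open>x > 1\<close>, so eventually the square
  stays away from \<open>0\<close> while \<open>T\<^sub>k\<^sub>+\<^sub>2 \<ge> T\<^sub>k\<close>; hence the \<open>q\<^sub>j(t)\<close> are bounded below by a positive constant.
\<close>

section \<open>The recurrence for the Taylor terms\<close>

definition taylor_monom :: "real \<Rightarrow> real \<Rightarrow> nat \<Rightarrow> real poly" where
  "taylor_monom \<alpha> \<kappa> k = monom ((\<alpha> gchoose k) * \<kappa> powr (2 * (\<alpha> - real k))) (2 * k)"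

definition coeff_ratio :: "real \<Rightarrow> nat \<Rightarrow> real" where
  "coeff_ratio \<alpha> k = (real k - \<alpha>) / (real k + 1)"

lemma taylor_trunc_eq_sum_monom:
  "taylor_trunc \<alpha> \<kappa> K t = (\<Sum>k\<le>K. poly (taylor_monom \<alpha> \<kappa> k) t)"
  by (simp add: taylor_trunc_def taylor_monom_def poly_monom atMost_atLeast0)

lemma gbinomial_Suc_ratio:
  fixes \<alpha> :: real
  shows "\<alpha> gchoose Suc k = - coeff_ratio \<alpha> k * (\<alpha> gchoose k)"
  using gbinomial_mult_1[of \<alpha> k] by (simp add: coeff_ratio_def field_simps)

lemma poly_taylor_monom_Suc:
  assumes "\<kappa> > 0"
  shows "poly (taylor_monom \<alpha> \<kappa> (Suc k)) t =
         - coeff_ratio \<alpha> k * (t / \<kappa>)\<^sup>2 * poly (taylor_monom \<alpha> \<kappa> k) t"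
proof -
  have "\<kappa> powr (2 * (\<alpha> - real (Suc k))) = \<kappa> powr (2 * (\<alpha> - real k) - 2)"
    by (simp add: algebra_simps)
  also have "\<dots> = \<kappa> powr (2 * (\<alpha> - real k)) / \<kappa>\<^sup>2"
    using assms by (subst powr_diff) (simp add: powr_numeral)
  finally show ?thesis
    unfolding taylor_monom_def poly_monom gbinomial_Suc_ratio
    by (simp add: power2_eq_square)
qed

lemma coeff_ratio_pos: "real k > \<alpha> \<Longrightarrow> coeff_ratio \<alpha> k > 0"
  by (simp add: coeff_ratio_def)

text \<open>
  Because \<open>\<rho>\<^sub>k = 1 - (\<alpha> + 1) / (k + 1)\<close>. For \<open>k > \<alpha>\<close>, where \<open>\<rho>\<^sub>k\<close> is the quotient of consecutive
  absolute values, this says that the absolute values of the coefficients are strictly log-convex.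
\<close>

lemma coeff_ratio_strict_mono:
  assumes "\<alpha> > -1"
  shows "strict_mono (coeff_ratio \<alpha>)"
proof (rule strict_monoI_Suc)
  fix k
  have "coeff_ratio \<alpha> (Suc k) - coeff_ratio \<alpha> k = (\<alpha> + 1) / ((real k + 1) * (real k + 2))"
    by (simp add: coeff_ratio_def field_simps)
  also have "\<dots> > 0"
    using assms by simp
  finally show "coeff_ratio \<alpha> k < coeff_ratio \<alpha> (Suc k)"
    by simp
qed

lemma coeff_ratio_tendsto_1: "coeff_ratio \<alpha> \<longlonglongrightarrow> 1"
  unfolding coeff_ratio_def by real_asymp

lemma gbinomial_pos_initial:
  fixes \<alpha> :: real
  assumes "\<alpha> > real n - 1" "k \<le> n"
  shows "\<alpha> gchoose k > 0"
  using assms(2)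
proof (induction k)
  case (Suc k)
  then have "coeff_ratio \<alpha> k < 0"
    using assms(1) by (simp add: coeff_ratio_def divide_neg_pos)
  then show ?case
    using Suc by (simp add: gbinomial_Suc_ratio mult_neg_pos)
qed simp

lemma gbinomial_pos_even_offset:
  fixes \<alpha> :: real
  assumes "\<alpha> > real n - 1" "\<alpha> < real n"
  shows "\<alpha> gchoose (n + 2 * i) > 0"
proof (induction i)
  case 0
  show ?case
    using gbinomial_pos_initial[OF assms(1)] by simp
next
  case (Suc i)
  have "\<alpha> gchoose (n + 2 * Suc i)
        = coeff_ratio \<alpha> (Suc (n + 2 * i)) * coeff_ratio \<alpha> (n + 2 * i) * (\<alpha> gchoose (n + 2 * i))"
    by (simp add: gbinomial_Suc_ratio)
  then show ?case
    using Suc assms by (simp add: coeff_ratio_pos)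
qed

lemma poly_taylor_monom_nonneg:
  assumes "\<alpha> gchoose k > 0"
  shows "poly (taylor_monom \<alpha> \<kappa> k) t \<ge> 0"
  using assms by (simp add: taylor_monom_def poly_monom power_mult)

lemma poly_taylor_monom_pos:
  assumes "\<alpha> gchoose k > 0" "\<kappa> > 0" "t > 0"
  shows "poly (taylor_monom \<alpha> \<kappa> k) t > 0"
  using assms by (simp add: taylor_monom_def poly_monom)

section \<open>Grouping the alternating tail\<close>

definition taylor_group :: "real \<Rightarrow> real \<Rightarrow> nat \<Rightarrow> real poly" where
  "taylor_group \<alpha> \<kappa> k = smult (1/2)
     (taylor_monom \<alpha> \<kappa> k + smult 2 (taylor_monom \<alpha> \<kappa> (k + 1)) + taylor_monom \<alpha> \<kappa> (k + 2))"

lemma sum_monom_eq_sum_group: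
  "(\<Sum>k\<le>n + 2 * J. poly (taylor_monom \<alpha> \<kappa> k) t) =
     (\<Sum>k<n. poly (taylor_monom \<alpha> \<kappa> k) t) + poly (taylor_monom \<alpha> \<kappa> n) t / 2
     + (\<Sum>j=1..J. poly (taylor_group \<alpha> \<kappa> (n + 2 * j - 2)) t)
     + poly (taylor_monom \<alpha> \<kappa> (n + 2 * J)) t / 2"
proof (induction J)
  case 0
  show ?case
    by (simp add: lessThan_Suc_atMost[symmetric])
next
  case (Suc J)
  then show ?case
    by (simp add: taylor_group_def field_simps)
qed

text \<open>
  Completing the square leaves as remainder exactly the amount by which log-convexity is strict.
\<close>

lemma poly_taylor_group_eq:
  assumes "\<kappa> > 0"
  shows "poly (taylor_group \<alpha> \<kappa> k) t = poly (taylor_monom \<alpha> \<kappa> k) t / 2 *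
    ((1 - coeff_ratio \<alpha> k * (t / \<kappa>)\<^sup>2)\<^sup>2
     + coeff_ratio \<alpha> k * (coeff_ratio \<alpha> (Suc k) - coeff_ratio \<alpha> k) * ((t / \<kappa>)\<^sup>2)\<^sup>2)"
  unfolding taylor_group_def
  by (simp add: poly_taylor_monom_Suc[OF assms] power2_eq_square algebra_simps)

context
  fixes \<alpha> \<kappa> :: real and k :: nat
  assumes \<kappa>: "\<kappa> > 0" and \<alpha>: "\<alpha> > -1" and k: "real k > \<alpha>" and pos: "\<alpha> gchoose k > 0"
begin

lemma convexity_defect_pos:
  "coeff_ratio \<alpha> k * (coeff_ratio \<alpha> (Suc k) - coeff_ratio \<alpha> k) > 0"
  using coeff_ratio_pos[OF k] strict_monoD[OF coeff_ratio_strict_mono[OF \<alpha>], of k "Suc k"]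
  by simp

lemma taylor_group_ge_square:
  "poly (taylor_group \<alpha> \<kappa> k) t \<ge>
     poly (taylor_monom \<alpha> \<kappa> k) t / 2 * (1 - coeff_ratio \<alpha> k * (t / \<kappa>)\<^sup>2)\<^sup>2"
  unfolding poly_taylor_group_eq[OF \<kappa>]
  using poly_taylor_monom_nonneg[OF pos, of \<kappa> t] convexity_defect_pos
  by (intro mult_left_mono) simp_all

lemma taylor_group_ge_defect:
  "poly (taylor_group \<alpha> \<kappa> k) t \<ge> poly (taylor_monom \<alpha> \<kappa> k) t / 2 *
     (coeff_ratio \<alpha> k * (coeff_ratio \<alpha> (Suc k) - coeff_ratio \<alpha> k) * ((t / \<kappa>)\<^sup>2)\<^sup>2)"
  unfolding poly_taylor_group_eq[OF \<kappa>]
  using poly_taylor_monom_nonneg[OF pos, of \<kappa> t]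
  by (intro mult_left_mono) simp_all

lemma nonneg_taylor_group: "nonneg_poly (taylor_group \<alpha> \<kappa> k)"
  unfolding nonneg_poly_def
proof
  fix t
  have "0 \<le> poly (taylor_monom \<alpha> \<kappa> k) t / 2 * (1 - coeff_ratio \<alpha> k * (t / \<kappa>)\<^sup>2)\<^sup>2"
    using poly_taylor_monom_nonneg[OF pos, of \<kappa> t] by simp
  also note taylor_group_ge_square
  finally show "poly (taylor_group \<alpha> \<kappa> k) t \<ge> 0" .
qed

lemma taylor_group_ge_power:
  "\<exists>C>0. \<forall>t. poly (taylor_group \<alpha> \<kappa> k) t \<ge> C * t ^ (2 * k + 4)"
proof (intro exI conjI allI)
  define C where "C = (\<alpha> gchoose k) * \<kappa> powr (2 * (\<alpha> - real k)) / 2 *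
    (coeff_ratio \<alpha> k * (coeff_ratio \<alpha> (Suc k) - coeff_ratio \<alpha> k)) / \<kappa> ^ 4"
  show "C > 0"
    using pos \<kappa> convexity_defect_pos by (simp add: C_def)
  fix t
  have "((t / \<kappa>)\<^sup>2)\<^sup>2 = t ^ 4 / \<kappa> ^ 4"
    by (simp add: power_divide flip: power_mult)
  then have "C * t ^ (2 * k + 4) = poly (taylor_monom \<alpha> \<kappa> k) t / 2 *
     (coeff_ratio \<alpha> k * (coeff_ratio \<alpha> (Suc k) - coeff_ratio \<alpha> k) * ((t / \<kappa>)\<^sup>2)\<^sup>2)"
    by (simp add: C_def taylor_monom_def poly_monom power_add)
  also note taylor_group_ge_defect
  finally show "C * t ^ (2 * k + 4) \<le> poly (taylor_group \<alpha> \<kappa> k) t" .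
qed

end

section \<open>Divergence beyond the radius of convergence\<close>

lemma filterlim_sum_at_top_if_bounded_below:
  fixes f :: "nat \<Rightarrow> real"
  assumes nonneg: "\<And>j. j \<ge> 1 \<Longrightarrow> f j \<ge> 0"
    and bound: "\<And>j. j \<ge> N \<Longrightarrow> f j \<ge> \<eta>"
    and "\<eta> > 0"
  shows "filterlim (\<lambda>J. \<Sum>j=1..J. f j) at_top sequentially"
proof (rule filterlim_at_top_mono)
  show "filterlim (\<lambda>J. (real J - real N) * \<eta>) at_top sequentially"
    using \<open>\<eta> > 0\<close> by real_asymp
  have "(real J - real N) * \<eta> \<le> (\<Sum>j=1..J. f j)" for J
  proof (induction J)
    case 0
    show ?case
      using \<open>\<eta> > 0\<close> by simp
  next
    case (Suc J)
    show ?case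
    proof (cases "Suc J \<ge> N")
      case True
      then show ?thesis
        using Suc bound[of "Suc J"] by (simp add: algebra_simps)
    next
      case False
      then have "(real (Suc J) - real N) * \<eta> \<le> 0"
        using \<open>\<eta> > 0\<close> by (intro mult_nonpos_nonneg) simp_all
      also have "0 \<le> (\<Sum>j=1..Suc J. f j)"
        using nonneg by (intro sum_nonneg) simp
      finally show ?thesis .
    qed
  qed
  then show "\<forall>\<^sub>F J in sequentially. (real J - real N) * \<eta> \<le> (\<Sum>j=1..J. f j)"
    by simp
qed

context
  fixes \<alpha> \<kappa> :: real and n :: nat
  assumes \<kappa>: "\<kappa> > 0" and \<alpha>: "\<alpha> > 0" and n: "\<alpha> > real n - 1" "\<alpha> < real n"
begin

lemma monom_even_offset_le:
  assumes large: "\<And>k. k \<ge> n + 2 * N \<Longrightarrow> coeff_ratio \<alpha> k * (t / \<kappa>)\<^sup>2 \<ge> 1"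
    and "N \<le> i"
  shows "poly (taylor_monom \<alpha> \<kappa> (n + 2 * N)) t \<le> poly (taylor_monom \<alpha> \<kappa> (n + 2 * i)) t"
  using \<open>N \<le> i\<close>
proof (induction i rule: dec_induct)
  case (step i)
  define k where "k = n + 2 * i"
  let ?T = "\<lambda>k. poly (taylor_monom \<alpha> \<kappa> k) t"
  have "1 * 1 \<le> (coeff_ratio \<alpha> (Suc k) * (t / \<kappa>)\<^sup>2) * (coeff_ratio \<alpha> k * (t / \<kappa>)\<^sup>2)"
    using step.hyps by (intro mult_mono large order_trans[OF _ large]) (simp_all add: k_def)
  moreover have "?T k \<ge> 0"
    using gbinomial_pos_even_offset[OF n, of i] by (simp add: k_def poly_taylor_monom_nonneg)
  ultimately have "?T k \<le>
      (coeff_ratio \<alpha> (Suc k) * (t / \<kappa>)\<^sup>2) * (coeff_ratio \<alpha> k * (t / \<kappa>)\<^sup>2) * ?T k"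
    by (simp add: mult_le_cancel_right1 not_less)
  also have "\<dots> = ?T (n + 2 * Suc i)"
    by (simp add: k_def poly_taylor_monom_Suc[OF \<kappa>])
  finally show ?case
    using step.IH by (simp add: k_def)
qed simp

lemma filterlim_sum_taylor_group:
  assumes "t > \<kappa>"
  shows "filterlim (\<lambda>J. \<Sum>j=1..J. poly (taylor_group \<alpha> \<kappa> (n + 2 * j - 2)) t) at_top sequentially"
proof -
  define x where "x = (t / \<kappa>)\<^sup>2"
  have x: "x > 1"
    using assms \<kappa> by (simp add: x_def)
  \<comment> \<open>A margin that \<open>\<rho>\<^sub>k x\<close>, with limit \<open>x = 1 + 2\<delta>\<close>, eventually keeps above \<open>1\<close>.\<close>
  define \<delta> where "\<delta> = (x - 1) / 2"
  have \<delta>: "\<delta> > 0" "(1 + \<delta>) / x < 1"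
    using x by (simp_all add: \<delta>_def field_simps)
  have "\<forall>\<^sub>F k in sequentially. coeff_ratio \<alpha> k > (1 + \<delta>) / x"
    using order_tendstoD(1)[OF coeff_ratio_tendsto_1 \<delta>(2)] .
  then obtain N where N: "\<And>k. k \<ge> N \<Longrightarrow> coeff_ratio \<alpha> k > (1 + \<delta>) / x"
    by (auto simp: eventually_sequentially)
  have large: "coeff_ratio \<alpha> k * x \<ge> 1 + \<delta>" if "k \<ge> n + 2 * N" for k
    using N[of k] that x by (simp add: field_simps)
  define \<eta> where "\<eta> = poly (taylor_monom \<alpha> \<kappa> (n + 2 * N)) t / 2 * \<delta>\<^sup>2"
  have "\<eta> > 0"
    using poly_taylor_monom_pos[OF gbinomial_pos_even_offset[OF n], of \<kappa> t N] assms \<kappa> \<delta>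
    by (simp add: \<eta>_def)
  have group: "nonneg_poly (taylor_group \<alpha> \<kappa> (n + 2 * i))"
    "poly (taylor_group \<alpha> \<kappa> (n + 2 * i)) t \<ge>
       poly (taylor_monom \<alpha> \<kappa> (n + 2 * i)) t / 2 * (1 - coeff_ratio \<alpha> (n + 2 * i) * x)\<^sup>2" for i
    using \<kappa> \<alpha> n gbinomial_pos_even_offset[OF n, of i] unfolding x_def
    by (intro nonneg_taylor_group taylor_group_ge_square; simp)+
  have bound: "poly (taylor_group \<alpha> \<kappa> (n + 2 * i)) t \<ge> \<eta>" if "i \<ge> N" for i
  proof -
    have "\<delta> \<le> coeff_ratio \<alpha> (n + 2 * i) * x - 1"
      using large[of "n + 2 * i"] that by simp
    then have "\<delta>\<^sup>2 \<le> (1 - coeff_ratio \<alpha> (n + 2 * i) * x)\<^sup>2"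
      using \<delta>(1) power_mono[of \<delta> _ 2] power2_commute[of _ 1] by (metis less_imp_le)
    moreover have "poly (taylor_monom \<alpha> \<kappa> (n + 2 * N)) t \<le> poly (taylor_monom \<alpha> \<kappa> (n + 2 * i)) t"
    proof (rule monom_even_offset_le[OF _ that])
      show "coeff_ratio \<alpha> k * (t / \<kappa>)\<^sup>2 \<ge> 1" if "k \<ge> n + 2 * N" for k
        using large[OF that] \<delta>(1) unfolding x_def by linarith
    qed
    ultimately have "\<eta> \<le>
        poly (taylor_monom \<alpha> \<kappa> (n + 2 * i)) t / 2 * (1 - coeff_ratio \<alpha> (n + 2 * i) * x)\<^sup>2"
      unfolding \<eta>_def
      using poly_taylor_monom_nonneg[OF gbinomial_pos_even_offset[OF n], of \<kappa> i t]
      by (intro mult_mono) simp_all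
    then show ?thesis
      using group(2)[of i] by linarith
  qed
  have shift: "n + 2 * j - 2 = n + 2 * (j - 1)" if "j \<ge> 1" for j
    using that by simp
  show ?thesis
  proof (rule filterlim_sum_at_top_if_bounded_below[OF _ _ \<open>\<eta> > 0\<close>])
    show "poly (taylor_group \<alpha> \<kappa> (n + 2 * j - 2)) t \<ge> 0" if "j \<ge> 1" for j
      using group(1)[of "j - 1"] that by (simp add: shift nonneg_poly_def)
    show "poly (taylor_group \<alpha> \<kappa> (n + 2 * j - 2)) t \<ge> \<eta>" if "j \<ge> N + 1" for j
      using bound[of "j - 1"] that by (simp add: shift)
  qed
qed

text \<open>
  The terms of the grouped sum that are dropped here have even offset or index below \<open>n\<close>, so they
  are non-negative. The constant term \<open>T\<^sub>0\<close> is kept because it alone is positive at \<open>t = 0\<close>.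
\<close>

lemma taylor_trunc_ge_sum_group:
  "taylor_trunc \<alpha> \<kappa> (n + 2 * J) t \<ge>
     \<kappa> powr (2 * \<alpha>) + (\<Sum>j=1..J. poly (taylor_group \<alpha> \<kappa> (n + 2 * j - 2)) t)"
proof -
  have "n > 0"
    using \<alpha> n(2) by (cases n) simp_all
  then have "\<kappa> powr (2 * \<alpha>) = (\<Sum>k\<in>{0}. poly (taylor_monom \<alpha> \<kappa> k) t)"
    by (simp add: taylor_monom_def poly_monom)
  also have "\<dots> \<le> (\<Sum>k<n. poly (taylor_monom \<alpha> \<kappa> k) t)"
    using \<open>n > 0\<close> gbinomial_pos_initial[OF n(1)]
    by (intro sum_mono2 poly_taylor_monom_nonneg) auto
  finally show ?thesis
    unfolding taylor_trunc_eq_sum_monom sum_monom_eq_sum_group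
    using poly_taylor_monom_nonneg[OF gbinomial_pos_even_offset[OF n, of J], of \<kappa> t]
      poly_taylor_monom_nonneg[OF gbinomial_pos_even_offset[OF n, of 0], of \<kappa> t]
    by simp
qed

lemma nonneg_taylor_group_offset:
  assumes "j \<ge> 1"
  shows "nonneg_poly (taylor_group \<alpha> \<kappa> (n + 2 * j - 2))"
proof -
  have "n + 2 * j - 2 = n + 2 * (j - 1)"
    using assms by simp
  then show ?thesis
    using \<kappa> \<alpha> n gbinomial_pos_even_offset[OF n, of "j - 1"]
    by (simp only:) (intro nonneg_taylor_group; simp)
qed

text \<open>
  The group \<open>j = 1\<close> is needed for the exponent: the term \<open>T\<^sub>n\<close> alone grows like \<open>t\<close> to the
  power \<open>2n\<close>, and \<open>2n\<close> is only \<open>d + 1\<close> if \<open>d\<close> is odd and \<open>[\<alpha>] = (d - 1) / 2\<close>.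
\<close>

lemma taylor_trunc_ge_power:
  assumes "e \<le> 2 * n + 4"
  shows "\<exists>c>0. \<forall>J\<ge>1. \<forall>t\<ge>0. c * (1 + t ^ e) \<le> taylor_trunc \<alpha> \<kappa> (n + 2 * J) t"
proof -
  obtain C where C: "C > 0" "\<And>t. C * t ^ (2 * n + 4) \<le> poly (taylor_group \<alpha> \<kappa> n) t"
    using taylor_group_ge_power[of \<kappa> \<alpha> n] \<kappa> \<alpha> n gbinomial_pos_initial[OF n(1), of n] by auto
  define c where "c = min (\<kappa> powr (2 * \<alpha>)) C"
  have c: "c > 0" "c \<le> \<kappa> powr (2 * \<alpha>)" "c \<le> C"
    using \<kappa> C(1) by (simp_all add: c_def)
  have "c / 2 * (1 + t ^ e) \<le> taylor_trunc \<alpha> \<kappa> (n + 2 * J) t" if J: "J \<ge> 1" and t: "t \<ge> 0" for J t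
  proof -
    have "t ^ e \<le> 1 + t ^ (2 * n + 4)"
    proof (cases "t \<le> 1")
      case True
      then show ?thesis
        using t power_le_one[of t e] by (simp add: add_increasing2)
    next
      case False
      then show ?thesis
        using power_increasing[OF assms, of t] by linarith
    qed
    then have "1 + t ^ e \<le> 2 * (1 + t ^ (2 * n + 4))"
      using zero_le_power[OF t, of "2 * n + 4"] unfolding distrib_left by linarith
    then have "c / 2 * (1 + t ^ e) \<le> c / 2 * (2 * (1 + t ^ (2 * n + 4)))"
      using c(1) by (intro mult_left_mono) simp_all
    also have "\<dots> = c + c * t ^ (2 * n + 4)"
      by (simp add: distrib_left)
    also have "\<dots> \<le> \<kappa> powr (2 * \<alpha>) + C * t ^ (2 * n + 4)"
      using c t by (intro add_mono mult_right_mono) simp_all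
    also have "\<dots> \<le> \<kappa> powr (2 * \<alpha>) + (\<Sum>j\<in>{1}. poly (taylor_group \<alpha> \<kappa> (n + 2 * j - 2)) t)"
      using C(2)[of t] by simp
    also have "\<dots> \<le> \<kappa> powr (2 * \<alpha>) + (\<Sum>j=1..J. poly (taylor_group \<alpha> \<kappa> (n + 2 * j - 2)) t)"
      using J nonneg_taylor_group_offset
      by (intro add_left_mono sum_mono2) (auto simp: nonneg_poly_def)
    also note taylor_trunc_ge_sum_group
    finally show ?thesis .
  qed
  then show ?thesis
    using c(1) by (intro exI[of _ "c / 2"]) simp
qed

end

section \<open>The lower bounds on Euclidean space\<close>

theorem lemma4p2:
  fixes \<alpha> \<kappa> :: real
  assumes "\<alpha> > real CARD('d::finite) / 2"
    and "\<alpha> \<notin> \<int>"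
    and "\<kappa> > 0"
  shows "(\<exists>c>0. \<forall>J\<ge>1. \<forall>\<xi> :: real ^ 'd.
            c * (1 + norm \<xi> ^ (CARD('d) + 2)) \<le> taylor_trunc \<alpha> \<kappa> (trunc_order \<alpha> J) (norm \<xi>)) \<and>
         (\<exists>q :: nat \<Rightarrow> real poly.
            (\<forall>j\<ge>1. nonneg_poly (q j)) \<and>
            (\<forall>J\<ge>1. \<forall>\<xi> :: real ^ 'd.
               (\<Sum>j=1..J. poly (q j) (norm \<xi>)) \<le> taylor_trunc \<alpha> \<kappa> (trunc_order \<alpha> J) (norm \<xi>)) \<and>
            (\<forall>t>\<kappa>. filterlim (\<lambda>J. \<Sum>j=1..J. poly (q j) t) at_top sequentially))"
proof -
  define n where "n = nat \<lfloor>\<alpha>\<rfloor> + 1"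
  have \<alpha>: "\<alpha> > 0"
    using assms(1) order.strict_trans1[of 0 "real CARD('d) / 2" \<alpha>] by simp
  then have floor: "real n = of_int \<lfloor>\<alpha>\<rfloor> + 1"
    by (simp add: n_def)
  have "of_int \<lfloor>\<alpha>\<rfloor> \<noteq> \<alpha>"
    using assms(2) by (metis Ints_of_int)
  then have n: "\<alpha> > real n - 1" "\<alpha> < real n"
    using floor of_int_floor_le[of \<alpha>] floor_correct[of \<alpha>] by linarith+
  have trunc_order_eq: "trunc_order \<alpha> J = n + 2 * J" for J
    by (simp add: trunc_order_def n_def)
  have "real CARD('d) < 2 * real n"
    using assms(1) n(2) by linarith
  then have dim: "CARD('d) + 2 \<le> 2 * n + 4"
    by linarith
  note ctxt = \<open>\<kappa> > 0\<close> \<alpha> n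
  show ?thesis
  proof (intro conjI exI[of _ "\<lambda>j. taylor_group \<alpha> \<kappa> (n + 2 * j - 2)"] allI impI)
    show "\<exists>c>0. \<forall>J\<ge>1. \<forall>\<xi> :: real ^ 'd.
        c * (1 + norm \<xi> ^ (CARD('d) + 2)) \<le> taylor_trunc \<alpha> \<kappa> (trunc_order \<alpha> J) (norm \<xi>)"
      using taylor_trunc_ge_power[OF ctxt dim] unfolding trunc_order_eq by (meson norm_ge_zero)
  next
    fix J :: nat and \<xi> :: "real ^ 'd"
    show "(\<Sum>j=1..J. poly (taylor_group \<alpha> \<kappa> (n + 2 * j - 2)) (norm \<xi>))
          \<le> taylor_trunc \<alpha> \<kappa> (trunc_order \<alpha> J) (norm \<xi>)"
      using taylor_trunc_ge_sum_group[OF ctxt, of "norm \<xi>" J] powr_ge_zero[of \<kappa> "2 * \<alpha>"]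
      unfolding trunc_order_eq by linarith
  qed (rule nonneg_taylor_group_offset[OF ctxt] filterlim_sum_taylor_group[OF ctxt], assumption)+
qed

end
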